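(* Let $\mathcal I\subseteq\{1,\dots,n\}$ be partitioned into nonempty sets $\mathcal I_o$ ("offices" $o=1,\dots,N$, $N\ge2$), with $m_o=|\mathcal I_o|$ and $m=\sum_o m_o$; let $\mathcal J_o\subseteq\{1,\dots,n\}$ be nonempty sets with $\mathcal J_o\cap\mathcal I_{o'}=\emptyset$ for all $o,o'$. Let $\Pi$ be the group of permutations $\pi\in\mathcal S_n$ with $\pi(j)=j$ for all $j\notin\mathcal I$ and $\pi(\mathcal I_o)=\mathcal I_o$ for all $o$. Let $A^0\in\{0,1\}^{n\times n}$ and $\mathcal A=\{A^0_\pi:\pi\in\Pi\}$. Assume: (1) $A^2=f(A^1)$, where $A^1,A^2$ are adjacency matrices in $\{0,1\}^{n\times n}$, both observed; (2) $P(A^1=A\mid f)=1/|\mathcal A|$ for all $A\in\mathcal A$; (3) for every $o$, every $(i,j)\in\mathcal I_o\times\mathcal J_o$ and every value $d$ attained by $d_{ij}$ on $\mathcal A$ there is a real number $Y_{ij}^d$ (depending only on $f$) such that for all $A\in\mathcal A$, $d_{ij}(A)=d$ implies $y_{ij}(f(A))=Y_{ij}^d$; (4) $d_{ij}(A_\pi)=d_{\pi(i),\pi(j)}(A)$ for all $\pi\in\Pi$, all $(i,j)\in\mathcal I_o\times\mathcal J_o$ and all $o$, and all $A\in\mathcal A$; (5) $\sum_{i\in\mathcal I_o}D_{ij}^2>0$ for all $o$ and $j\in\mathcal J_o$, where $D_{ij}=d_{ij}(A^1)\in\mathbb R$. With $Y_{ij}=y_{ij}(A^2)$ and $P_{ij}=\frac1{m_o}\sum_{l\in\mathcal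 I_o}\mathbf 1(D_{lj}=D_{ij})$ for $(i,j)\in\mathcal I_o\times\mathcal J_o$, let $$\widehat\beta_o=\operatorname*{argmin}_b\sum_{i\in\mathcal I_o,\,j\in\mathcal J_o}\frac1{P_{ij}}(Y_{ij}-D_{ij}b)^2,\qquad \widehat\gamma_o=\frac1{|\mathcal J_o|}\sum_{j\in\mathcal J_o}\operatorname*{argmin}_c\sum_{i\in\mathcal I_o}(Y_{ij}-D_{ij}c)^2,$$ $\widehat\beta=\sum_o\frac{m_o}m\widehat\beta_o$, $\widehat\gamma=\sum_o\frac{m_o}m\widehat\gamma_o$, $\sigma_\beta^2=\operatorname{Var}(\widehat\beta\mid f)$, $\sigma_\gamma^2=\operatorname{Var}(\widehat\gamma\mid f)$. Define $$\widehat V_\beta=\tfrac{N}{N-1}\sum_o\left(\tfrac{m_o}{m}\widehat\beta_o-\tfrac{\widehat\beta}{N}\right)^2,\qquad \widehat V_\gamma=\tfrac{N}{N-1}\sum_o\left(\tfrac{m_o}{m}\widehat\gamma_o-\tfrac{\widehat\gamma}{N}\right)^2.$$ Then $$E[\widehat V_\beta\mid f]\ge\sigma_\beta^2,\qquad E[\widehat V_\gamma\mid f]\ge\sigma_\gamma^2.$$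
   Context: $\mathcal S_n$ is the group of all permutations of $\{1,\dots,n\}$; for a matrix $A$ and a permutation $\pi$, $A_\pi$ is the matrix with $(i,j)$ entry $A_{\pi(i),\pi(j)}$. The map $f$ on adjacency matrices may be random; $\mathcal A$, the index sets, and the functions $d_{ij}$, $y_{ij}$ (real-valued) are non-random. Conditional on $f$, all randomness comes from the draw of $A^1$ from $\mathcal A$. *)

theory Defs
  imports "HOL-Probability.Probability"
begin

text \<open>
  The index set \<open>{1,...,n}\<close> is a finite type \<open>'n\<close>. Offices are numbered \<open>1..N\<close>;
  \<open>I k\<close> and \<open>J k\<close> are the two index sets attached to office \<open>k\<close>.
\<close>

definition adj_mats :: "(nat^'n^'n) set" where
  "adj_mats = {A. \<forall>i j. A $ i $ j \<in> {0, 1}}"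

definition permute_mat :: "nat^'n^'n \<Rightarrow> ('n \<Rightarrow> 'n) \<Rightarrow> nat^'n^'n" where
  "permute_mat A \<pi> = (\<chi> i j. A $ \<pi> i $ \<pi> j)"

definition office_perms :: "nat \<Rightarrow> (nat \<Rightarrow> 'n set) \<Rightarrow> ('n \<Rightarrow> 'n) set" where
  "office_perms N I =
     {\<pi>. \<pi> permutes UNIV \<and> (\<forall>j. j \<notin> (\<Union>k\<in>{1..N}. I k) \<longrightarrow> \<pi> j = j) \<and>
         (\<forall>k\<in>{1..N}. \<pi> ` I k = I k)}"

definition permuted_mats :: "nat \<Rightarrow> (nat \<Rightarrow> 'n set) \<Rightarrow> nat^'n^'n \<Rightarrow> (nat^'n^'n) set" where
  "permuted_mats N I A0 = permute_mat A0 ` office_perms N I"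

text \<open>
  Below, \<open>D\<close> and \<open>Y\<close> are the realised arrays \<open>D\<^sub>i\<^sub>j\<close> and \<open>Y\<^sub>i\<^sub>j\<close>, and \<open>S\<close>, \<open>T\<close> are the
  index sets of a single office.
\<close>

definition prop_score :: "'n set \<Rightarrow> ('n \<Rightarrow> 'n \<Rightarrow> real) \<Rightarrow> 'n \<Rightarrow> 'n \<Rightarrow> real" where
  "prop_score S D i j = 1 / real (card S) * (\<Sum>l\<in>S. of_bool (D l j = D i j))"

definition office_beta ::
    "'n set \<Rightarrow> 'n set \<Rightarrow> ('n \<Rightarrow> 'n \<Rightarrow> real) \<Rightarrow> ('n \<Rightarrow> 'n \<Rightarrow> real) \<Rightarrow> real" where
  "office_beta S T D Y =
     (ARG_MIN (\<lambda>b. \<Sum>(i, j)\<in>S \<times> T. 1 / prop_score S D i j * (Y i j - D i j * b)\<^sup>2) b. True)"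

definition office_gamma ::
    "'n set \<Rightarrow> 'n set \<Rightarrow> ('n \<Rightarrow> 'n \<Rightarrow> real) \<Rightarrow> ('n \<Rightarrow> 'n \<Rightarrow> real) \<Rightarrow> real" where
  "office_gamma S T D Y =
     1 / real (card T) *
       (\<Sum>j\<in>T. ARG_MIN (\<lambda>c. \<Sum>i\<in>S. (Y i j - D i j * c)\<^sup>2) c. True)"

definition office_share :: "nat \<Rightarrow> (nat \<Rightarrow> 'n set) \<Rightarrow> nat \<Rightarrow> real" where
  "office_share N I k = real (card (I k)) / real (\<Sum>l=1..N. card (I l))"

definition pooled :: "nat \<Rightarrow> (nat \<Rightarrow> 'n set) \<Rightarrow> (nat \<Rightarrow> real) \<Rightarrow> real" where
  "pooled N I e = (\<Sum>k=1..N. office_share N I k * e k)"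

definition var_estimator :: "nat \<Rightarrow> (nat \<Rightarrow> 'n set) \<Rightarrow> (nat \<Rightarrow> real) \<Rightarrow> real" where
  "var_estimator N I e =
     real N / (real N - 1) *
       (\<Sum>k=1..N. (office_share N I k * e k - pooled N I e / real N)\<^sup>2)"

definition beta_hat ::
    "nat \<Rightarrow> (nat \<Rightarrow> 'n set) \<Rightarrow> (nat \<Rightarrow> 'n set) \<Rightarrow> ('n \<Rightarrow> 'n \<Rightarrow> real) \<Rightarrow> ('n \<Rightarrow> 'n \<Rightarrow> real) \<Rightarrow> real" where
  "beta_hat N I J D Y = pooled N I (\<lambda>k. office_beta (I k) (J k) D Y)"

definition gamma_hat ::
    "nat \<Rightarrow> (nat \<Rightarrow> 'n set) \<Rightarrow> (nat \<Rightarrow> 'n set) \<Rightarrow> ('n \<Rightarrow> 'n \<Rightarrow> real) \<Rightarrow> ('n \<Rightarrow> 'n \<Rightarrow> real) \<Rightarrow> real" where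
  "gamma_hat N I J D Y = pooled N I (\<lambda>k. office_gamma (I k) (J k) D Y)"

definition V_beta ::
    "nat \<Rightarrow> (nat \<Rightarrow> 'n set) \<Rightarrow> (nat \<Rightarrow> 'n set) \<Rightarrow> ('n \<Rightarrow> 'n \<Rightarrow> real) \<Rightarrow> ('n \<Rightarrow> 'n \<Rightarrow> real) \<Rightarrow> real" where
  "V_beta N I J D Y = var_estimator N I (\<lambda>k. office_beta (I k) (J k) D Y)"

definition V_gamma ::
    "nat \<Rightarrow> (nat \<Rightarrow> 'n set) \<Rightarrow> (nat \<Rightarrow> 'n set) \<Rightarrow> ('n \<Rightarrow> 'n \<Rightarrow> real) \<Rightarrow> ('n \<Rightarrow> 'n \<Rightarrow> real) \<Rightarrow> real" where
  "V_gamma N I J D Y = var_estimator N I (\<lambda>k. office_gamma (I k) (J k) D Y)"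

text \<open>
  A random map on adjacency matrices is a random element of the finite set
  \<open>adj_mats \<rightarrow>\<^sub>E adj_mats\<close>: its values outside \<open>adj_mats\<close> carry no information and are
  normalised to \<open>undefined\<close>.
\<close>

definition map_space :: "(nat^'n^'n \<Rightarrow> nat^'n^'n) measure" where
  "map_space = count_space (adj_mats \<rightarrow>\<^sub>E adj_mats)"

definition sigma_gen :: "'w measure \<Rightarrow> ('w \<Rightarrow> nat^'n^'n \<Rightarrow> nat^'n^'n) \<Rightarrow> 'w measure" where
  "sigma_gen M f = vimage_algebra (space M) f map_space"

definition cond_variance :: "'w measure \<Rightarrow> 'w measure \<Rightarrow> ('w \<Rightarrow> real) \<Rightarrow> 'w \<Rightarrow> real" where
  "cond_variance M F X = real_cond_exp M F (\<lambda>\<omega>. (X \<omega> - real_cond_exp M F X \<omega>)\<^sup>2)"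

end

theory Submission imports Defs begin

text \<open>
  Conditionally on \<open>f\<close>, the matrix \<open>A1\<close> is uniform on an orbit of the product group of the
  office-wise symmetric groups. By equivariance and the exposure condition, the estimator of office
  \<open>k\<close> depends on the permutation only through its restriction to \<open>I k\<close>, so estimators of
  different offices are uncorrelated. For uncorrelated summands the variance of the sum
  is the sum of the variances, while the rescaled empirical spread has as its mean this same sum plus
  a nonnegative multiple of the spread of the means.
\<close>

section \<open>Variance decomposition for sums over a finite sample\<close>

lemma sum_squared_deviations:
  fixes z :: "'k \<Rightarrow> real"
  assumes "finite K" "K \<noteq> {}"
  shows "(\<Sum>k\<in>K. (z k - (\<Sum>l\<in>K. z l) / card K)\<^sup>2) = (\<Sum>k\<in>K. (z k)\<^sup>2) - (\<Sum>k\<in>K. z k)\<^sup>2 / card K"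
proof -
  define s where "s = (\<Sum>l\<in>K. z l)"
  have c: "real (card K) > 0" using assms by (simp add: card_gt_0_iff)
  have "(\<Sum>k\<in>K. (z k - s / card K)\<^sup>2)
      = (\<Sum>k\<in>K. (z k)\<^sup>2 - 2 * s / card K * z k + s\<^sup>2 / (card K)\<^sup>2)"
    by (intro sum.cong) (auto simp: power2_eq_square algebra_simps)
  also have "\<dots> = (\<Sum>k\<in>K. (z k)\<^sup>2) - 2 * s / card K * s + card K * (s\<^sup>2 / (card K)\<^sup>2)"
    by (simp add: sum.distrib sum_subtractf sum_distrib_left s_def)
  also have "\<dots> = (\<Sum>k\<in>K. (z k)\<^sup>2) - s\<^sup>2 / card K"
    using c by (simp add: field_simps power2_eq_square)
  finally show ?thesis by (simp add: s_def)
qed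

text \<open>Uncorrelatedness is stated with denominators cleared: dividing by the square of
  \<open>card S\<close> gives equality of the mean of the product and the product of the means.
  Centring each summand makes different summands orthogonal, so the total variance is the sum of the
  single ones. In the spread over \<open>K\<close>, the centred parts contribute exactly the
  fraction \<open>1 - 1 / card K\<close> of that sum, which the leading factor cancels; the spread
  of the means adds only nonnegative terms.\<close>

lemma variance_sum_uncorrelated_le:
  fixes x :: "'k \<Rightarrow> 'a \<Rightarrow> real"
  assumes S: "finite S" "S \<noteq> {}" and K: "finite K" "2 \<le> card K"
    and uncorrelated: "\<And>k l. k \<in> K \<Longrightarrow> l \<in> K \<Longrightarrow> k \<noteq> l \<Longrightarrow>
      (\<Sum>a\<in>S. x k a * x l a) * card S = (\<Sum>a\<in>S. x k a) * (\<Sum>a\<in>S. x l a)"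
  shows "(\<Sum>a\<in>S. ((\<Sum>k\<in>K. x k a) - (\<Sum>b\<in>S. \<Sum>k\<in>K. x k b) / card S)\<^sup>2)
    \<le> (\<Sum>a\<in>S. real (card K) / (real (card K) - 1) * (\<Sum>k\<in>K. (x k a - (\<Sum>l\<in>K. x l a) / card K)\<^sup>2))"
proof -
  have S0: "real (card S) > 0" using S by (simp add: card_gt_0_iff)
  have K0: "K \<noteq> {}" using K by auto
  define \<mu> where "\<mu> k = (\<Sum>a\<in>S. x k a) / card S" for k
  define z where "z k a = x k a - \<mu> k" for k a
  define Q where "Q = (\<Sum>k\<in>K. \<Sum>a\<in>S. (z k a)\<^sup>2)"
  have z0: "(\<Sum>a\<in>S. z k a) = 0" for k
    using S0 by (simp add: z_def \<mu>_def sum_subtractf)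
  \<comment> \<open>One factor is expanded at a time: while the other factor sums to zero, the
    constant \<open>\<mu> k\<close> drops out.\<close>
  have zz: "(\<Sum>a\<in>S. z k a * z l a) = 0" if "k \<in> K" "l \<in> K" "k \<noteq> l" for k l
  proof -
    have "(\<Sum>a\<in>S. z k a * z l a) = (\<Sum>a\<in>S. x k a * z l a) - \<mu> k * (\<Sum>a\<in>S. z l a)"
      by (simp add: z_def[of k] left_diff_distrib sum_subtractf sum_distrib_left)
    also have "\<dots> = (\<Sum>a\<in>S. x k a * x l a) - \<mu> l * (\<Sum>a\<in>S. x k a)"
      by (simp add: z0) (simp add: z_def right_diff_distrib sum_subtractf sum_distrib_left mult.commute)
    also have "\<dots> = 0" using uncorrelated[OF that] S0 by (simp add: \<mu>_def field_simps)
    finally show ?thesis .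
  qed
  have Q: "(\<Sum>a\<in>S. (\<Sum>k\<in>K. z k a)\<^sup>2) = Q"
  proof -
    have "(\<Sum>a\<in>S. (\<Sum>k\<in>K. z k a)\<^sup>2) = (\<Sum>a\<in>S. \<Sum>k\<in>K. \<Sum>l\<in>K. z k a * z l a)"
      by (simp add: power2_eq_square sum_product)
    also have "\<dots> = (\<Sum>k\<in>K. \<Sum>a\<in>S. \<Sum>l\<in>K. z k a * z l a)" by (rule sum.swap)
    also have "\<dots> = (\<Sum>k\<in>K. \<Sum>l\<in>K. \<Sum>a\<in>S. z k a * z l a)"
      by (intro sum.cong refl sum.swap)
    also have "\<dots> = (\<Sum>k\<in>K. \<Sum>l\<in>K. if l = k then \<Sum>a\<in>S. (z k a)\<^sup>2 else 0)"
      by (intro sum.cong refl) (auto simp: zz power2_eq_square)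
    also have "\<dots> = Q" using K by (simp add: Q_def)
    finally show ?thesis .
  qed
  have lhs: "(\<Sum>k\<in>K. x k a) - (\<Sum>b\<in>S. \<Sum>k\<in>K. x k b) / card S = (\<Sum>k\<in>K. z k a)" for a
    by (subst sum.swap) (simp add: z_def \<mu>_def sum_subtractf sum_divide_distrib)
  \<comment> \<open>The deviation of \<open>x k a\<close> from the average over \<open>K\<close>
    splits into a part \<open>u\<close> that sums to zero over the sample and a part
    \<open>c\<close> that is constant on it.\<close>
  define u where "u k a = z k a - (\<Sum>l\<in>K. z l a) / card K" for k a
  define c where "c k = \<mu> k - (\<Sum>l\<in>K. \<mu> l) / card K" for k
  have u0: "(\<Sum>a\<in>S. u k a) = 0" for k
    by (simp add: u_def sum_subtractf z0 flip: sum_divide_distrib) (subst sum.swap, simp add: z0)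
  have dev: "x k a - (\<Sum>l\<in>K. x l a) / card K = u k a + c k" for k a
    by (simp add: u_def c_def z_def sum_subtractf diff_divide_distrib)
  \<comment> \<open>For each \<open>a\<close>, the squared deviations of \<open>z\<close> total the
    sum of squares minus the squared sum over \<open>card K\<close>. Summed over the sample, both
    the sum of squares and the squared sum give \<open>Q\<close>, the latter by
    orthogonality.\<close>
  have "(real (card K) - 1) / card K * Q = Q - Q / card K"
    using K0 K(1) by (simp add: field_simps)
  also have "\<dots> = (\<Sum>a\<in>S. \<Sum>k\<in>K. (u k a)\<^sup>2)"
    unfolding u_def sum_squared_deviations[OF K(1) K0] sum_subtractf
    by (subst sum.swap) (simp add: Q Q_def flip: sum_divide_distrib)
  also have "\<dots> = (\<Sum>k\<in>K. \<Sum>a\<in>S. (u k a)\<^sup>2)" by (rule sum.swap)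
  also have "\<dots> \<le> (\<Sum>k\<in>K. \<Sum>a\<in>S. (u k a + c k)\<^sup>2)"
  proof (rule sum_mono)
    fix k
    \<comment> \<open>The cross term vanishes because \<open>u k\<close> sums to zero; the discarded
      squares of \<open>c k\<close> are the slack of the whole inequality.\<close>
    have "(\<Sum>a\<in>S. (u k a + c k)\<^sup>2) = (\<Sum>a\<in>S. (u k a)\<^sup>2 + 2 * c k * u k a + (c k)\<^sup>2)"
      by (simp add: power2_eq_square algebra_simps)
    also have "\<dots> = (\<Sum>a\<in>S. (u k a)\<^sup>2) + card S * (c k)\<^sup>2"
      by (simp add: sum.distrib u0 flip: sum_distrib_left)
    finally show "(\<Sum>a\<in>S. (u k a)\<^sup>2) \<le> (\<Sum>a\<in>S. (u k a + c k)\<^sup>2)" by simp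
  qed
  also have "\<dots> = (\<Sum>a\<in>S. \<Sum>k\<in>K. (u k a + c k)\<^sup>2)" by (rule sum.swap)
  finally have "Q \<le> real (card K) / (real (card K) - 1) * (\<Sum>a\<in>S. \<Sum>k\<in>K. (u k a + c k)\<^sup>2)"
    using K by (simp add: field_simps)
  then show ?thesis using K by (simp only: lhs Q dev sum_distrib_left)
qed

section \<open>The office-wise permutation group and sums over its orbit\<close>

text \<open>The entries have the infinite type \<open>nat\<close>, but a 0/1 matrix is determined by
  the positions of its ones, and there are finitely many sets of positions.\<close>

lemma finite_adj_mats: "finite (adj_mats :: (nat^'n^'n) set)"
proof (rule finite_imageD)
  show "finite ((\<lambda>A::nat^'n^'n. {(i, j). A $ i $ j = 1}) ` adj_mats)" by simp
  show "inj_on (\<lambda>A::nat^'n^'n. {(i, j). A $ i $ j = 1}) adj_mats"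
  proof (rule inj_onI)
    fix A B :: "nat^'n^'n"
    assume A: "A \<in> adj_mats" and B: "B \<in> adj_mats"
      and eq: "{(i, j). A $ i $ j = 1} = {(i, j). B $ i $ j = 1}"
    have "A $ i $ j = B $ i $ j" for i j
    proof -
      have "A $ i $ j = 1 \<longleftrightarrow> B $ i $ j = 1" using eq by (auto simp: set_eq_iff)
      moreover have "A $ i $ j \<in> {0, 1}" "B $ i $ j \<in> {0, 1}"
        using A B by (auto simp: adj_mats_def)
      ultimately show ?thesis by auto
    qed
    then show "A = B" by (simp add: vec_eq_iff)
  qed
qed

text \<open>Relabelling is a right action. Hence moving the base point of the orbit by
  \<open>\<sigma>\<close> becomes left translation by \<open>\<sigma>\<close> in the group.\<close>

lemma permute_mat_comp: "permute_mat (permute_mat A \<pi>) \<rho> = permute_mat A (\<pi> \<circ> \<rho>)"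
  by (simp add: permute_mat_def)

lemma permute_mat_id: "permute_mat A id = A"
  by (simp add: permute_mat_def)

lemma inj_permute_mat:
  fixes \<pi> :: "'n::finite \<Rightarrow> 'n"
  assumes "surj \<pi>"
  shows "inj (\<lambda>A. permute_mat A \<pi>)"
proof (rule injI)
  fix A B :: "nat^'n^'n"
  assume eq: "permute_mat A \<pi> = permute_mat B \<pi>"
  have "permute_mat (permute_mat A \<pi>) (inv \<pi>) = permute_mat (permute_mat B \<pi>) (inv \<pi>)"
    by (simp add: eq)
  with assms show "A = B"
    by (simp add: permute_mat_comp permute_mat_id surj_iff)
qed

lemma office_perms_surj: "\<pi> \<in> office_perms N I \<Longrightarrow> surj \<pi>"
  by (auto simp: office_perms_def dest: permutes_surj)

lemma office_perms_inj: "\<pi> \<in> office_perms N I \<Longrightarrow> inj \<pi>"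
  by (auto simp: office_perms_def dest: permutes_inj)

lemma office_perms_fixes:
  "\<pi> \<in> office_perms N I \<Longrightarrow> j \<notin> (\<Union>k\<in>{1..N}. I k) \<Longrightarrow> \<pi> j = j"
  by (auto simp: office_perms_def)

lemma id_office_perms: "id \<in> office_perms N I"
  by (auto simp: office_perms_def permutes_def)

lemma office_perms_comp:
  assumes "\<pi> \<in> office_perms N I" "\<rho> \<in> office_perms N I"
  shows "\<pi> \<circ> \<rho> \<in> office_perms N I"
proof -
  have "(\<pi> \<circ> \<rho>) ` I k = I k" if "k \<in> {1..N}" for k
    using assms that by (simp only: office_perms_def mem_Collect_eq image_comp[symmetric])
  with assms show ?thesis by (auto simp: office_perms_def permutes_compose)
qed

text \<open>The group is a direct product over offices: as the sets \<open>I l\<close> are disjoint,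
  the component of \<open>\<pi>\<close> on one office, extended by the identity, preserves all the
  others. This allows averaging over a single office.\<close>

lemma office_perms_restrict:
  assumes \<pi>: "\<pi> \<in> office_perms N I" and dis: "disjoint_family_on I {1..N}" and k: "k \<in> {1..N}"
  shows "(\<lambda>i. if i \<in> I k then \<pi> i else i) \<in> office_perms N I"
proof -
  let ?r = "\<lambda>i. if i \<in> I k then \<pi> i else i"
  have im: "\<pi> ` I k = I k" using \<pi> k by (auto simp: office_perms_def)
  have "bij_betw ?r (I k) (I k)"
    using im office_perms_inj[OF \<pi>] by (auto simp: bij_betw_def inj_on_def)
  moreover have "bij_betw ?r (- I k) (- I k)"
    by (auto simp: bij_betw_def inj_on_def)
  ultimately have "bij_betw ?r (I k \<union> - I k) (I k \<union> - I k)"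
    by (rule bij_betw_combine) auto
  then have "?r permutes UNIV" by (simp add: permutes_univ bij_iff)
  moreover have "?r ` I l = I l" if l: "l \<in> {1..N}" for l
  proof (cases "l = k")
    case True
    then show ?thesis using im by simp
  next
    case False
    then have "I l \<inter> I k = {}" using dis l k by (auto simp: disjoint_family_on_def)
    then have "?r ` I l = id ` I l" by (intro image_cong) auto
    then show ?thesis by simp
  qed
  moreover have "?r j = j" if "j \<notin> (\<Union>k\<in>{1..N}. I k)" for j
    using that k by auto
  ultimately show ?thesis unfolding office_perms_def by blast
qed

lemma finite_office_perms: "finite (office_perms N (I :: nat \<Rightarrow> 'n::finite set))"
  by (rule finite_subset[OF subset_UNIV]) simp

lemma finite_permuted_mats: "finite (permuted_mats N I A0)"
  by (simp add: permuted_mats_def finite_office_perms)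

lemma permuted_mats_nonempty: "permuted_mats N I A0 \<noteq> {}"
  using id_office_perms[of N I] by (auto simp: permuted_mats_def)

lemma permuted_mats_subset: "A0 \<in> adj_mats \<Longrightarrow> permuted_mats N I A0 \<subseteq> adj_mats"
proof -
  assume "A0 \<in> adj_mats"
  then have "permute_mat A0 \<pi> \<in> adj_mats" for \<pi> by (simp add: adj_mats_def permute_mat_def)
  then show ?thesis by (auto simp: permuted_mats_def)
qed

lemma permute_mat_permuted_mats:
  assumes "A \<in> permuted_mats N I A0" "\<pi> \<in> office_perms N I"
  shows "permute_mat A \<pi> \<in> permuted_mats N I A0"
  using assms by (auto simp: permuted_mats_def permute_mat_comp office_perms_comp)

text \<open>Invariance of the uniform distribution on the orbit: the action maps this finite set
  injectively into itself, hence bijectively.\<close>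

lemma sum_permuted_mats_shift:
  assumes \<pi>: "\<pi> \<in> office_perms N I"
  shows "(\<Sum>A\<in>permuted_mats N I A0. g (permute_mat A \<pi>)) = (\<Sum>A\<in>permuted_mats N I A0. g A)"
proof (rule sum.reindex_bij_betw)
  have inj: "inj_on (\<lambda>A. permute_mat A \<pi>) (permuted_mats N I A0)"
    using inj_permute_mat[OF office_perms_surj[OF \<pi>]] by (rule inj_on_subset) simp
  moreover have "(\<lambda>A. permute_mat A \<pi>) ` permuted_mats N I A0 = permuted_mats N I A0"
    by (rule endo_inj_surj[OF finite_permuted_mats _ inj]) (use permute_mat_permuted_mats \<pi> in blast)
  ultimately show "bij_betw (\<lambda>A. permute_mat A \<pi>) (permuted_mats N I A0) (permuted_mats N I A0)"
    by (simp add: bij_betw_def)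
qed

lemma sum_office_perms_shift:
  assumes \<sigma>: "\<sigma> \<in> office_perms N (I :: nat \<Rightarrow> 'n::finite set)"
  shows "(\<Sum>\<pi>\<in>office_perms N I. g (\<sigma> \<circ> \<pi>)) = (\<Sum>\<pi>\<in>office_perms N I. g \<pi>)"
proof (rule sum.reindex_bij_betw)
  have inj: "inj_on ((\<circ>) \<sigma>) (office_perms N I)"
    using office_perms_inj[OF \<sigma>] by (auto simp: inj_on_def fun_eq_iff)
  moreover have "(\<circ>) \<sigma> ` office_perms N I = office_perms N I"
    by (rule endo_inj_surj[OF finite_office_perms _ inj]) (use office_perms_comp \<sigma> in blast)
  ultimately show "bij_betw ((\<circ>) \<sigma>) (office_perms N I) (office_perms N I)"
    by (simp add: bij_betw_def)
qed

text \<open>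
  Averaging over the permutations of office \<open>k\<close> leaves \<open>v\<close> alone and replaces \<open>u\<close> by its mean.
\<close>

lemma sum_permuted_mats_uncorrelated:
  fixes u v :: "nat^'n^'n \<Rightarrow> real"
  assumes dis: "disjoint_family_on I {1..N}" and k: "k \<in> {1..N}"
    and u: "\<And>A \<pi> \<rho>. A \<in> permuted_mats N I A0 \<Longrightarrow> \<pi> \<in> office_perms N I \<Longrightarrow> \<rho> \<in> office_perms N I \<Longrightarrow>
      (\<forall>i\<in>I k. \<pi> i = \<rho> i) \<Longrightarrow> u (permute_mat A \<pi>) = u (permute_mat A \<rho>)"
    and v: "\<And>A \<pi>. A \<in> permuted_mats N I A0 \<Longrightarrow> \<pi> \<in> office_perms N I \<Longrightarrow>
      (\<forall>i. i \<notin> I k \<longrightarrow> \<pi> i = i) \<Longrightarrow> v (permute_mat A \<pi>) = v A"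
  shows "(\<Sum>A\<in>permuted_mats N I A0. u A * v A) * card (permuted_mats N I A0)
    = (\<Sum>A\<in>permuted_mats N I A0. u A) * (\<Sum>A\<in>permuted_mats N I A0. v A)"
proof -
  let ?S = "permuted_mats N I A0" and ?P = "office_perms N I"
  define c where "c = (\<Sum>\<pi>\<in>?P. u (permute_mat A0 \<pi>))"
  have P0: "real (card ?P) > 0"
    using id_office_perms[of N I] finite_office_perms[of N I] by (auto simp: card_gt_0_iff)
  \<comment> \<open>The group average of \<open>u\<close> does not depend on the starting point in
    the orbit: writing \<open>A\<close> as a relabelling of \<open>A0\<close> by
    \<open>\<sigma>\<close> turns the change of starting point into a translation of the
    group.\<close>
  have c: "(\<Sum>\<pi>\<in>?P. u (permute_mat A \<pi>)) = c" if "A \<in> ?S" for A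
  proof -
    from that obtain \<sigma> where \<sigma>: "\<sigma> \<in> ?P" "A = permute_mat A0 \<sigma>" by (auto simp: permuted_mats_def)
    then show ?thesis
      using sum_office_perms_shift[OF \<sigma>(1), of "\<lambda>\<pi>. u (permute_mat A0 \<pi>)"]
      by (simp add: permute_mat_comp c_def)
  qed
  \<comment> \<open>Stated for a general \<open>w\<close> because it is used twice, for
    \<open>v\<close> and for the constant 1.\<close>
  have mean: "card ?P * (\<Sum>A\<in>?S. u A * w A) = c * (\<Sum>A\<in>?S. w A)"
    if w: "\<And>A \<pi>. A \<in> ?S \<Longrightarrow> \<pi> \<in> ?P \<Longrightarrow> (\<forall>i. i \<notin> I k \<longrightarrow> \<pi> i = i) \<Longrightarrow> w (permute_mat A \<pi>) = w A"
    for w :: "nat^'n^'n \<Rightarrow> real"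
  proof -
    have avg: "(\<Sum>A\<in>?S. u A * w A) = (\<Sum>A\<in>?S. u (permute_mat A \<pi>) * w A)" if \<pi>: "\<pi> \<in> ?P" for \<pi>
    proof -
      \<comment> \<open>Shifting the sum by \<open>?r\<close> keeps \<open>w\<close>, since
        \<open>?r\<close> moves only points of \<open>I k\<close>; \<open>u\<close> cannot
        distinguish \<open>?r\<close> from \<open>\<pi>\<close>, since they agree on
        \<open>I k\<close>.\<close>
      let ?r = "\<lambda>i. if i \<in> I k then \<pi> i else i"
      have r: "?r \<in> ?P" by (rule office_perms_restrict[OF \<pi> dis k])
      have "(\<Sum>A\<in>?S. u A * w A) = (\<Sum>A\<in>?S. u (permute_mat A ?r) * w (permute_mat A ?r))"
        by (rule sum_permuted_mats_shift[OF r, symmetric])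
      also have "\<dots> = (\<Sum>A\<in>?S. u (permute_mat A \<pi>) * w A)"
        by (intro sum.cong refl arg_cong2[where f = "(*)"] u w r \<pi>) auto
      finally show ?thesis .
    qed
    have "(\<Sum>\<pi>\<in>?P. \<Sum>A\<in>?S. u A * w A) = (\<Sum>\<pi>\<in>?P. \<Sum>A\<in>?S. u (permute_mat A \<pi>) * w A)"
      by (rule sum.cong[OF refl avg])
    also have "\<dots> = (\<Sum>A\<in>?S. (\<Sum>\<pi>\<in>?P. u (permute_mat A \<pi>)) * w A)"
      by (subst sum.swap) (simp add: sum_distrib_right)
    finally show ?thesis by (simp add: c sum_distrib_left)
  qed
  have "card ?P * (\<Sum>A\<in>?S. u A * v A) = c * (\<Sum>A\<in>?S. v A)" by (rule mean[OF v])
  \<comment> \<open>Taking \<open>w\<close> constant expresses \<open>c\<close> through the sum of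
    \<open>u\<close>; eliminating \<open>c\<close> from the two equations gives the product
    formula.\<close>
  moreover have "card ?P * (\<Sum>A\<in>?S. u A) = c * card ?S" using mean[of "\<lambda>_. 1"] by simp
  ultimately have "card ?P * ((\<Sum>A\<in>?S. u A * v A) * card ?S) = card ?P * ((\<Sum>A\<in>?S. u A) * (\<Sum>A\<in>?S. v A))"
    by algebra
  then show ?thesis using P0 by (simp only: mult_cancel_left) auto
qed

section \<open>The variance inequality for a fixed map\<close>

text \<open>The parameter \<open>est\<close> stands for either office estimator;
  \<open>local\<close> says that it reads its arrays only on \<open>I k\<close> times
  \<open>J k\<close>. With the map fixed, treatments there determine outcomes there, and a
  permutation acts on these treatments through the row index alone, so estimates of different
  offices are uncorrelated on the orbit.\<close>

lemma pooled_variance_le_mean_var_estimator: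
  fixes d y :: "'n \<Rightarrow> 'n \<Rightarrow> nat^'n^'n \<Rightarrow> real" and \<phi> :: "nat^'n^'n \<Rightarrow> nat^'n^'n"
    and est :: "nat \<Rightarrow> ('n \<Rightarrow> 'n \<Rightarrow> real) \<Rightarrow> ('n \<Rightarrow> 'n \<Rightarrow> real) \<Rightarrow> real"
  assumes N: "N \<ge> 2" and dis: "disjoint_family_on I {1..N}"
    and IJ: "\<forall>k\<in>{1..N}. \<forall>l\<in>{1..N}. J k \<inter> I l = {}"
    and exposure: "\<forall>k\<in>{1..N}. \<forall>i\<in>I k. \<forall>j\<in>J k. \<forall>\<delta>\<in>d i j ` permuted_mats N I A0.
      \<exists>Yd::real. \<forall>A\<in>permuted_mats N I A0. d i j A = \<delta> \<longrightarrow> y i j (\<phi> A) = Yd"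
    and equivariance: "\<forall>\<pi>\<in>office_perms N I. \<forall>k\<in>{1..N}. \<forall>i\<in>I k. \<forall>j\<in>J k.
      \<forall>A\<in>permuted_mats N I A0. d i j (permute_mat A \<pi>) = d (\<pi> i) (\<pi> j) A"
    and local: "\<And>k D D' Y Y'. k \<in> {1..N} \<Longrightarrow> \<forall>i\<in>I k. \<forall>j\<in>J k. D i j = D' i j \<and> Y i j = Y' i j \<Longrightarrow>
      est k D Y = est k D' Y'"
  defines "S \<equiv> permuted_mats N I A0"
    and "e \<equiv> \<lambda>A k. est k (\<lambda>i j. d i j A) (\<lambda>i j. y i j (\<phi> A))"
  shows "(\<Sum>A\<in>S. (pooled N I (e A) - (\<Sum>B\<in>S. pooled N I (e B)) / card S)\<^sup>2)
    \<le> (\<Sum>A\<in>S. var_estimator N I (e A))"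
proof -
  have e_eq: "e A k = e B k"
    if "k \<in> {1..N}" "A \<in> S" "B \<in> S" "\<And>i j. i \<in> I k \<Longrightarrow> j \<in> J k \<Longrightarrow> d i j A = d i j B" for A B k
  proof -
    have "y i j (\<phi> A) = y i j (\<phi> B)" if ij: "i \<in> I k" "j \<in> J k" for i j
    proof -
      have "d i j A \<in> d i j ` S" using \<open>A \<in> S\<close> by simp
      then obtain Yd where "\<forall>C\<in>S. d i j C = d i j A \<longrightarrow> y i j (\<phi> C) = Yd"
        using exposure \<open>k \<in> {1..N}\<close> ij unfolding S_def by blast
      then show ?thesis using \<open>A \<in> S\<close> \<open>B \<in> S\<close> \<open>\<And>i j. i \<in> I k \<Longrightarrow> j \<in> J k \<Longrightarrow> d i j A = d i j B\<close> ij
        by metis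
    qed
    then show ?thesis unfolding e_def using that by (intro local) auto
  qed
  \<comment> \<open>The column index stays put because \<open>J k\<close> avoids every office, and
    points outside the offices are fixed by the group.\<close>
  have d_perm: "d i j (permute_mat A \<pi>) = d (\<pi> i) j A"
    if "\<pi> \<in> office_perms N I" "k \<in> {1..N}" "i \<in> I k" "j \<in> J k" "A \<in> S" for \<pi> k i j A
  proof -
    have "j \<notin> I l" if "l \<in> {1..N}" for l
      using IJ \<open>k \<in> {1..N}\<close> \<open>j \<in> J k\<close> that by blast
    then have "\<pi> j = j" by (intro office_perms_fixes[OF that(1)]) blast
    then show ?thesis using equivariance that unfolding S_def by metis
  qed
  \<comment> \<open>With the share absorbed into \<open>x\<close>, the pooled estimate is a plain
    sum and \<open>pooled / N\<close> is its average over the offices.\<close>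
  define x where "x k A = office_share N I k * e A k" for k A
  have unc: "(\<Sum>A\<in>S. x k A * x l A) * card S = (\<Sum>A\<in>S. x k A) * (\<Sum>A\<in>S. x l A)"
    if k: "k \<in> {1..N}" and l: "l \<in> {1..N}" and "k \<noteq> l" for k l
  proof -
    have kl: "I k \<inter> I l = {}" using that dis by (auto simp: disjoint_family_on_def)
    show ?thesis unfolding S_def
    proof (rule sum_permuted_mats_uncorrelated[OF dis k], fold S_def)
      fix A \<pi> \<rho>
      assume *: "A \<in> S" "\<pi> \<in> office_perms N I" "\<rho> \<in> office_perms N I" "\<forall>i\<in>I k. \<pi> i = \<rho> i"
      then have "e (permute_mat A \<pi>) k = e (permute_mat A \<rho>) k"
        by (intro e_eq[OF k]) (auto simp: S_def permute_mat_permuted_mats d_perm[OF _ k, unfolded S_def])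
      then show "x k (permute_mat A \<pi>) = x k (permute_mat A \<rho>)" by (simp add: x_def)
    next
      fix A \<pi>
      assume *: "A \<in> S" "\<pi> \<in> office_perms N I" "\<forall>i. i \<notin> I k \<longrightarrow> \<pi> i = i"
      \<comment> \<open>A permutation moving only points of \<open>I k\<close> fixes the disjoint
        set \<open>I l\<close> pointwise, so the treatments entering the estimate of office
        \<open>l\<close> are unchanged.\<close>
      moreover have "\<pi> i = i" if "i \<in> I l" for i using * kl that by blast
      ultimately have "e (permute_mat A \<pi>) l = e A l"
        by (intro e_eq[OF l]) (auto simp: S_def permute_mat_permuted_mats d_perm[OF _ l, unfolded S_def])
      then show "x l (permute_mat A \<pi>) = x l A" by (simp add: x_def)
    qed
  qed
  have "finite S" "S \<noteq> {}" by (simp_all add: S_def finite_permuted_mats permuted_mats_nonempty)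
  from variance_sum_uncorrelated_le[OF this, of "{1..N}" x] unc N
  show ?thesis
    by (simp add: pooled_def var_estimator_def x_def of_nat_diff)
qed

section \<open>Conditional expectations given the random map\<close>

text \<open>Almost surely \<open>W\<close> is the sum of \<open>h (f \<omega>) a\<close> times the
  indicator of \<open>X = a\<close>. Each coefficient is measurable with respect to \<open>f\<close>
  and can be taken out, which leaves the conditional probabilities, all equal to
  \<open>1 / card S\<close>.\<close>

lemma real_cond_exp_uniform:
  fixes f :: "'w \<Rightarrow> 'z" and X :: "'w \<Rightarrow> 'a" and h :: "'z \<Rightarrow> 'a \<Rightarrow> real"
  assumes "prob_space M"
    and f: "f \<in> M \<rightarrow>\<^sub>M count_space Z" and "finite Z"
    and X: "X \<in> M \<rightarrow>\<^sub>M count_space T" and T: "finite T"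
    and S: "S \<subseteq> T" "S \<noteq> {}"
    and uniform: "\<And>a. a \<in> S \<Longrightarrow> AE \<omega> in M.
      real_cond_exp M (vimage_algebra (space M) f (count_space Z)) (indicator {\<omega> \<in> space M. X \<omega> = a}) \<omega>
        = 1 / real (card S)"
    and W: "W \<in> borel_measurable M" "AE \<omega> in M. W \<omega> = h (f \<omega>) (X \<omega>)"
  shows "AE \<omega> in M. real_cond_exp M (vimage_algebra (space M) f (count_space Z)) W \<omega>
    = (\<Sum>a\<in>S. h (f \<omega>) a) / card S"
proof -
  interpret prob_space M by fact
  define F where "F = vimage_algebra (space M) f (count_space Z)"
  have fZ: "f \<in> space M \<rightarrow> Z" using measurable_space[OF f] by auto
  have subalg: "subalgebra M F"
    unfolding subalgebra_def F_def
    using measurable_sets[OF f] by (auto simp: sets_vimage_algebra2 fZ)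
  interpret F: sigma_finite_subalgebra M F
  proof -
    interpret finite_measure_subalgebra M F
      by unfold_locales (rule subalg)
    show "sigma_finite_subalgebra M F" by unfold_locales
  qed
  have finS: "finite S" using S T finite_subset by blast
  then have cS: "real (card S) > 0" using S by (simp add: card_gt_0_iff)
  define E where "E a = {\<omega> \<in> space M. X \<omega> = a}" for a
  have E: "E a \<in> sets M" if "a \<in> S" for a
  proof -
    have "E a = X -` {a} \<inter> space M" by (auto simp: E_def)
    then show ?thesis using measurable_sets[OF X, of "{a}"] that S by auto
  qed
  have iE: "integrable M (indicator (E a) :: _ \<Rightarrow> real)" if "a \<in> S" for a
    using E[OF that] by (intro integrable_real_indicator) (simp_all add: emeasure_eq_measure)
  have cE: "AE \<omega> in M. real_cond_exp M F (indicator (E a)) \<omega> = 1 / card S" if "a \<in> S" for a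
    using uniform[OF that] unfolding F_def E_def .
  \<comment> \<open>Integrating the conditional probabilities gives the unconditional ones. They add
    up to 1 over \<open>S\<close>, so \<open>X\<close> lies in \<open>S\<close> almost
    surely.\<close>
  have prE: "prob (E a) = 1 / card S" if "a \<in> S" for a
  proof -
    have "prob (E a) = (\<integral>\<omega>. indicator (E a) \<omega> \<partial>M)" using E[OF that] by simp
    also have "\<dots> = (\<integral>\<omega>. real_cond_exp M F (indicator (E a)) \<omega> \<partial>M)"
      using F.real_cond_exp_int(2)[OF iE[OF that]] by simp
    also have "\<dots> = (\<integral>\<omega>. 1 / card S \<partial>M)"
      by (rule integral_cong_AE) (use cE[OF that] in auto)
    finally show ?thesis by (simp add: prob_space)
  qed
  have "prob (\<Union>a\<in>S. E a) = (\<Sum>a\<in>S. prob (E a))"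
    using E finS by (intro finite_measure_finite_Union) (auto simp: disjoint_family_on_def E_def)
  also have "\<dots> = 1" using prE cS by simp
  finally have "AE \<omega> in M. \<omega> \<in> (\<Union>a\<in>S. E a)"
    using E finS by (subst (asm) prob_eq_1) auto
  with W(2) have W': "AE \<omega> in M. W \<omega> = (\<Sum>a\<in>S. h (f \<omega>) a * indicator (E a) \<omega>)"
  proof eventually_elim
    case (elim \<omega>)
    then have "(\<Sum>a\<in>S. h (f \<omega>) a * indicator (E a) \<omega>)
        = (\<Sum>a\<in>S. if a = X \<omega> then h (f \<omega>) a else 0)"
      by (intro sum.cong) (auto simp: E_def indicator_def)
    also have "\<dots> = h (f \<omega>) (X \<omega>)" using elim finS by (auto simp: E_def)
    finally show ?case using elim by simp
  qed
  have fF: "f \<in> F \<rightarrow>\<^sub>M count_space Z"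
    unfolding F_def by (rule measurable_vimage_algebra1) (simp add: fZ)
  have hF: "(\<lambda>\<omega>. h (f \<omega>) a) \<in> borel_measurable F" for a
    by (rule measurable_compose[OF fF]) simp
  have hM: "(\<lambda>\<omega>. h (f \<omega>) a) \<in> borel_measurable M" for a
    by (rule measurable_compose[OF f]) simp
  have ih: "integrable M (\<lambda>\<omega>. h (f \<omega>) a * indicator (E a) \<omega>)" if "a \<in> S" for a
  \<comment> \<open>As \<open>Z\<close> is finite, summing the absolute values over all of
    \<open>Z\<close> bounds the coefficient whatever value \<open>f\<close> takes.\<close>
  proof (rule integrable_const_bound[where B = "\<Sum>z\<in>Z. \<bar>h z a\<bar>"])
    show "AE \<omega> in M. norm (h (f \<omega>) a * indicator (E a) \<omega>) \<le> (\<Sum>z\<in>Z. \<bar>h z a\<bar>)"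
    proof (rule AE_I2)
      fix \<omega> assume "\<omega> \<in> space M"
      then have "f \<omega> \<in> Z" using fZ by auto
      then have "\<bar>h (f \<omega>) a\<bar> \<le> (\<Sum>z\<in>Z. \<bar>h z a\<bar>)"
        using \<open>finite Z\<close> by (intro member_le_sum[where f = "\<lambda>z. \<bar>h z a\<bar>"]) auto
      then show "norm (h (f \<omega>) a * indicator (E a) \<omega>) \<le> (\<Sum>z\<in>Z. \<bar>h z a\<bar>)"
        by (auto simp: indicator_def sum_nonneg)
    qed
    show "(\<lambda>\<omega>. h (f \<omega>) a * indicator (E a) \<omega>) \<in> borel_measurable M"
      using hM E[OF that] by measurable
  qed
  have "AE \<omega> in M. real_cond_exp M F W \<omega>
      = real_cond_exp M F (\<lambda>\<omega>. \<Sum>a\<in>S. h (f \<omega>) a * indicator (E a) \<omega>) \<omega>"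
    using W' W(1) by (rule F.real_cond_exp_cong) (intro borel_measurable_sum borel_measurable_integrable ih)
  moreover have "AE \<omega> in M. real_cond_exp M F (\<lambda>\<omega>. \<Sum>a\<in>S. h (f \<omega>) a * indicator (E a) \<omega>) \<omega>
      = (\<Sum>a\<in>S. real_cond_exp M F (\<lambda>\<omega>. h (f \<omega>) a * indicator (E a) \<omega>) \<omega>)"
  proof -
    \<comment> \<open>The rule for sums asks for integrability at every index, while it is known
      only for indices in \<open>S\<close>; hence the extension by zero.\<close>
    have "(\<Sum>a\<in>S. h (f \<omega>) a * indicator (E a) \<omega>)
        = (\<Sum>a\<in>S. if a \<in> S then h (f \<omega>) a * indicator (E a) \<omega> else 0)" for \<omega>
      by (intro sum.cong) auto
    moreover have "AE \<omega> in M. real_cond_exp M F (\<lambda>\<omega>. \<Sum>a\<in>S. if a \<in> S then h (f \<omega>) a * indicator (E a) \<omega> else 0) \<omega>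
      = (\<Sum>a\<in>S. real_cond_exp M F (\<lambda>\<omega>. if a \<in> S then h (f \<omega>) a * indicator (E a) \<omega> else 0) \<omega>)"
    proof (rule F.real_cond_exp_sum)
      show "integrable M (\<lambda>\<omega>. if a \<in> S then h (f \<omega>) a * indicator (E a) \<omega> else 0)" for a
        by (cases "a \<in> S") (simp_all add: ih)
    qed
    ultimately show ?thesis by simp
  qed
  moreover have "AE \<omega> in M. \<forall>a\<in>S. real_cond_exp M F (\<lambda>\<omega>. h (f \<omega>) a * indicator (E a) \<omega>) \<omega>
      = h (f \<omega>) a * real_cond_exp M F (indicator (E a)) \<omega>"
    using finS E by (intro AE_finite_allI F.real_cond_exp_mult hF ih) auto
  moreover have "AE \<omega> in M. \<forall>a\<in>S. real_cond_exp M F (indicator (E a)) \<omega> = 1 / card S"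
    using finS cE by (intro AE_finite_allI) auto
  ultimately show ?thesis unfolding F_def[symmetric]
    by eventually_elim (simp add: sum_divide_distrib)
qed

text \<open>Measurability comes from discreteness alone, with \<open>G\<close> arbitrary; this
  covers estimators defined through \<open>ARG_MIN\<close>.\<close>

lemma borel_measurable_finite_pair:
  fixes G :: "'a \<Rightarrow> 'b \<Rightarrow> real"
  assumes "X \<in> M \<rightarrow>\<^sub>M count_space T" "finite T" "X' \<in> M \<rightarrow>\<^sub>M count_space T'"
  shows "(\<lambda>\<omega>. G (X \<omega>) (X' \<omega>)) \<in> borel_measurable M"
  by (rule measurable_compose_countable'[OF measurable_compose[OF assms(3)] assms(1)])
    (use assms(2) in \<open>auto intro: countable_finite\<close>)

text \<open>Both conditional moments are averages over the orbit with the map frozen at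
  \<open>f \<omega>\<close>, so the inequality for a fixed map applies at almost every
  \<open>\<omega>\<close>.\<close>

lemma cond_variance_pooled_le:
  fixes M :: "'w measure"
    and A1 A2 :: "'w \<Rightarrow> nat^'n^'n"
    and f :: "'w \<Rightarrow> nat^'n^'n \<Rightarrow> nat^'n^'n"
    and d y :: "'n \<Rightarrow> 'n \<Rightarrow> nat^'n^'n \<Rightarrow> real"
    and est :: "nat \<Rightarrow> ('n \<Rightarrow> 'n \<Rightarrow> real) \<Rightarrow> ('n \<Rightarrow> 'n \<Rightarrow> real) \<Rightarrow> real"
  assumes M: "prob_space M"
    and f: "f \<in> M \<rightarrow>\<^sub>M map_space"
    and A1: "A1 \<in> M \<rightarrow>\<^sub>M count_space adj_mats"
    and A2: "A2 \<in> M \<rightarrow>\<^sub>M count_space adj_mats"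
    and N: "N \<ge> 2" and dis: "disjoint_family_on I {1..N}"
    and IJ: "\<forall>k\<in>{1..N}. \<forall>l\<in>{1..N}. J k \<inter> I l = {}"
    and A0: "A0 \<in> adj_mats"
    and observed: "AE \<omega> in M. A2 \<omega> = f \<omega> (A1 \<omega>)"
    and uniform: "\<forall>A\<in>permuted_mats N I A0.
      AE \<omega> in M. real_cond_exp M (sigma_gen M f) (indicator {\<omega> \<in> space M. A1 \<omega> = A}) \<omega>
        = 1 / real (card (permuted_mats N I A0))"
    and exposure: "AE \<omega> in M. \<forall>k\<in>{1..N}. \<forall>i\<in>I k. \<forall>j\<in>J k. \<forall>\<delta>\<in>d i j ` permuted_mats N I A0.
      \<exists>Yd::real. \<forall>A\<in>permuted_mats N I A0. d i j A = \<delta> \<longrightarrow> y i j (f \<omega> A) = Yd"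
    and equivariance: "\<forall>\<pi>\<in>office_perms N I. \<forall>k\<in>{1..N}. \<forall>i\<in>I k. \<forall>j\<in>J k.
      \<forall>A\<in>permuted_mats N I A0. d i j (permute_mat A \<pi>) = d (\<pi> i) (\<pi> j) A"
    and local: "\<And>k D D' Y Y'. k \<in> {1..N} \<Longrightarrow> \<forall>i\<in>I k. \<forall>j\<in>J k. D i j = D' i j \<and> Y i j = Y' i j \<Longrightarrow>
      est k D Y = est k D' Y'"
  shows "AE \<omega> in M.
    cond_variance M (sigma_gen M f)
      (\<lambda>\<omega>. pooled N I (\<lambda>k. est k (\<lambda>i j. d i j (A1 \<omega>)) (\<lambda>i j. y i j (A2 \<omega>)))) \<omega>
    \<le> real_cond_exp M (sigma_gen M f)
      (\<lambda>\<omega>. var_estimator N I (\<lambda>k. est k (\<lambda>i j. d i j (A1 \<omega>)) (\<lambda>i j. y i j (A2 \<omega>)))) \<omega>"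
proof -
  let ?S = "permuted_mats N I A0"
  let ?X = "\<lambda>\<omega>. pooled N I (\<lambda>k. est k (\<lambda>i j. d i j (A1 \<omega>)) (\<lambda>i j. y i j (A2 \<omega>)))"
  let ?V = "\<lambda>\<omega>. var_estimator N I (\<lambda>k. est k (\<lambda>i j. d i j (A1 \<omega>)) (\<lambda>i j. y i j (A2 \<omega>)))"
  let ?F = "sigma_gen M f"
  define e where "e \<phi> A k = est k (\<lambda>i j. d i j A) (\<lambda>i j. y i j (\<phi> A))" for \<phi> A k
  \<comment> \<open>The conditional mean is a function of the map only. The squared deviation from
    it is therefore again a function of \<open>f \<omega>\<close> and \<open>A1 \<omega>\<close>,
    and the same averaging formula yields the conditional variance.\<close>
  define mean where "mean \<phi> = (\<Sum>A\<in>?S. pooled N I (e \<phi> A)) / card ?S" for \<phi>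
  have cond_exp: "AE \<omega> in M. real_cond_exp M ?F W \<omega> = (\<Sum>A\<in>?S. h (f \<omega>) A) / card ?S"
    if "W \<in> borel_measurable M" "AE \<omega> in M. W \<omega> = h (f \<omega>) (A1 \<omega>)" for W h
    using uniform that f A1 unfolding sigma_gen_def map_space_def
    by (intro real_cond_exp_uniform[where T = adj_mats] M finite_adj_mats finite_PiE
        permuted_mats_subset[OF A0] permuted_mats_nonempty) auto
  have mX: "?X \<in> borel_measurable M"
    by (rule borel_measurable_finite_pair[OF A1 finite_adj_mats A2,
          of "\<lambda>A B. pooled N I (\<lambda>k. est k (\<lambda>i j. d i j A) (\<lambda>i j. y i j B))"])
  have mV: "?V \<in> borel_measurable M"
    by (rule borel_measurable_finite_pair[OF A1 finite_adj_mats A2,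
          of "\<lambda>A B. var_estimator N I (\<lambda>k. est k (\<lambda>i j. d i j A) (\<lambda>i j. y i j B))"])
  have X: "AE \<omega> in M. ?X \<omega> = pooled N I (e (f \<omega>) (A1 \<omega>))"
    using observed by eventually_elim (simp add: e_def[abs_def])
  have EX: "AE \<omega> in M. real_cond_exp M ?F ?X \<omega> = mean (f \<omega>)"
    unfolding mean_def by (rule cond_exp[OF mX X])
  have "AE \<omega> in M. (?X \<omega> - real_cond_exp M ?F ?X \<omega>)\<^sup>2
      = (pooled N I (e (f \<omega>) (A1 \<omega>)) - mean (f \<omega>))\<^sup>2"
    using X EX by eventually_elim simp
  then have "AE \<omega> in M. cond_variance M ?F ?X \<omega>
      = (\<Sum>A\<in>?S. (pooled N I (e (f \<omega>) A) - mean (f \<omega>))\<^sup>2) / card ?S"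
    unfolding cond_variance_def
    by (intro cond_exp[where h = "\<lambda>\<phi> A. (pooled N I (e \<phi> A) - mean \<phi>)\<^sup>2"])
      (use mX in measurable)
  moreover have "AE \<omega> in M. ?V \<omega> = var_estimator N I (e (f \<omega>) (A1 \<omega>))"
    using observed by eventually_elim (simp add: e_def[abs_def])
  then have "AE \<omega> in M. real_cond_exp M ?F ?V \<omega>
      = (\<Sum>A\<in>?S. var_estimator N I (e (f \<omega>) A)) / card ?S"
    by (rule cond_exp[OF mV])
  ultimately show ?thesis using exposure
  proof eventually_elim
    case (elim \<omega>)
    have "(\<Sum>A\<in>?S. (pooled N I (e (f \<omega>) A) - mean (f \<omega>))\<^sup>2)
        \<le> (\<Sum>A\<in>?S. var_estimator N I (e (f \<omega>) A))"
      unfolding mean_def e_def[abs_def]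
      by (rule pooled_variance_le_mean_var_estimator[where \<phi> = "f \<omega>" and d = d and y = y,
            OF N dis IJ elim(3) equivariance]) (rule local)
    then show ?case using elim(1,2) by (simp add: divide_right_mono)
  qed
qed

section \<open>Locality of the two estimators, and the conclusion\<close>

text \<open>The weight at \<open>(i, j)\<close> compares treatments only within column
  \<open>j\<close> and rows in \<open>S\<close>, so it is local as well. The two objectives then
  coincide as functions of \<open>b\<close>, and \<open>ARG_MIN\<close> selects the same
  point.\<close>

lemma office_beta_cong:
  assumes "\<forall>i\<in>S. \<forall>j\<in>T. D i j = D' i j \<and> Y i j = Y' i j"
  shows "office_beta S T D Y = office_beta S T D' Y'"
proof -
  have "prop_score S D i j = prop_score S D' i j" if "i \<in> S" "j \<in> T" for i j
    using assms that unfolding prop_score_def by (intro arg_cong2[where f = "(*)"] sum.cong) auto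
  then have "(\<lambda>b. \<Sum>(i, j)\<in>S \<times> T. 1 / prop_score S D i j * (Y i j - D i j * b)\<^sup>2)
      = (\<lambda>b. \<Sum>(i, j)\<in>S \<times> T. 1 / prop_score S D' i j * (Y' i j - D' i j * b)\<^sup>2)"
    using assms by (intro ext sum.cong) auto
  then show ?thesis unfolding office_beta_def by simp
qed

lemma office_gamma_cong:
  assumes "\<forall>i\<in>S. \<forall>j\<in>T. D i j = D' i j \<and> Y i j = Y' i j"
  shows "office_gamma S T D Y = office_gamma S T D' Y'"
proof -
  have "(\<lambda>c. \<Sum>i\<in>S. (Y i j - D i j * c)\<^sup>2) = (\<lambda>c. \<Sum>i\<in>S. (Y' i j - D' i j * c)\<^sup>2)" if "j \<in> T" for j
    using assms that by (intro ext sum.cong) auto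
  then show ?thesis unfolding office_gamma_def by simp
qed

theorem proposition5:
  fixes M :: "'w measure"
    and A1 A2 :: "'w \<Rightarrow> nat^'n^'n"
    and f :: "'w \<Rightarrow> nat^'n^'n \<Rightarrow> nat^'n^'n"
    and N :: nat
    and I J :: "nat \<Rightarrow> 'n set"
    and A0 :: "nat^'n^'n"
    and d y :: "'n \<Rightarrow> 'n \<Rightarrow> nat^'n^'n \<Rightarrow> real"
  assumes "prob_space M"
    and "f \<in> M \<rightarrow>\<^sub>M map_space"
    and "A1 \<in> M \<rightarrow>\<^sub>M count_space adj_mats"
    and "A2 \<in> M \<rightarrow>\<^sub>M count_space adj_mats"
    and "N \<ge> 2"
    and "disjoint_family_on I {1..N}"
    and "\<forall>k\<in>{1..N}. I k \<noteq> {}"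
    and "\<forall>k\<in>{1..N}. J k \<noteq> {}"
    and "\<forall>k\<in>{1..N}. \<forall>l\<in>{1..N}. J k \<inter> I l = {}"
    and "A0 \<in> adj_mats"
    and observed: "AE \<omega> in M. A2 \<omega> = f \<omega> (A1 \<omega>)"
    and uniform: "\<forall>A\<in>permuted_mats N I A0.
      AE \<omega> in M. real_cond_exp M (sigma_gen M f) (indicator {\<omega> \<in> space M. A1 \<omega> = A}) \<omega>
        = 1 / real (card (permuted_mats N I A0))"
    and exposure: "AE \<omega> in M. \<forall>k\<in>{1..N}. \<forall>i\<in>I k. \<forall>j\<in>J k. \<forall>\<delta>\<in>d i j ` permuted_mats N I A0.
      \<exists>Yd::real. \<forall>A\<in>permuted_mats N I A0. d i j A = \<delta> \<longrightarrow> y i j (f \<omega> A) = Yd"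
    and equivariance: "\<forall>\<pi>\<in>office_perms N I. \<forall>k\<in>{1..N}. \<forall>i\<in>I k. \<forall>j\<in>J k.
      \<forall>A\<in>permuted_mats N I A0. d i j (permute_mat A \<pi>) = d (\<pi> i) (\<pi> j) A"
    and nondegenerate: "AE \<omega> in M. \<forall>k\<in>{1..N}. \<forall>j\<in>J k. (\<Sum>i\<in>I k. (d i j (A1 \<omega>))\<^sup>2) > 0"
  shows "(AE \<omega> in M.
        real_cond_exp M (sigma_gen M f)
          (\<lambda>\<omega>. V_beta N I J (\<lambda>i j. d i j (A1 \<omega>)) (\<lambda>i j. y i j (A2 \<omega>))) \<omega>
        \<ge> cond_variance M (sigma_gen M f)
          (\<lambda>\<omega>. beta_hat N I J (\<lambda>i j. d i j (A1 \<omega>)) (\<lambda>i j. y i j (A2 \<omega>))) \<omega>) \<and>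
      (AE \<omega> in M.
        real_cond_exp M (sigma_gen M f)
          (\<lambda>\<omega>. V_gamma N I J (\<lambda>i j. d i j (A1 \<omega>)) (\<lambda>i j. y i j (A2 \<omega>))) \<omega>
        \<ge> cond_variance M (sigma_gen M f)
          (\<lambda>\<omega>. gamma_hat N I J (\<lambda>i j. d i j (A1 \<omega>)) (\<lambda>i j. y i j (A2 \<omega>))) \<omega>)"
proof
  \<comment> \<open>Both halves are instances of one inequality; they differ only in the office
    estimator, and its locality is the premise left open.\<close>
  note variance_le = cond_variance_pooled_le[where d = d and y = y,
      OF assms(1-6) assms(9,10) observed uniform exposure equivariance]
  show "AE \<omega> in M.
        real_cond_exp M (sigma_gen M f)
          (\<lambda>\<omega>. V_beta N I J (\<lambda>i j. d i j (A1 \<omega>)) (\<lambda>i j. y i j (A2 \<omega>))) \<omega>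
        \<ge> cond_variance M (sigma_gen M f)
          (\<lambda>\<omega>. beta_hat N I J (\<lambda>i j. d i j (A1 \<omega>)) (\<lambda>i j. y i j (A2 \<omega>))) \<omega>"
    unfolding V_beta_def beta_hat_def by (rule variance_le) (rule office_beta_cong)
  show "AE \<omega> in M.
        real_cond_exp M (sigma_gen M f)
          (\<lambda>\<omega>. V_gamma N I J (\<lambda>i j. d i j (A1 \<omega>)) (\<lambda>i j. y i j (A2 \<omega>))) \<omega>
        \<ge> cond_variance M (sigma_gen M f)
          (\<lambda>\<omega>. gamma_hat N I J (\<lambda>i j. d i j (A1 \<omega>)) (\<lambda>i j. y i j (A2 \<omega>))) \<omega>"
    unfolding V_gamma_def gamma_hat_def by (rule variance_le) (rule office_gamma_cong)
qed

end
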